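(* Suppose that a group $G$ admits a convergence action on a compact metrizable space $M$. Then every orbit uniform metric on $M$ is complete; that is, for every compatible metric $d$ on $M$, the metric space $(M,d_u)$ with $d_u(\xi,\eta)=\sup_{g\in G}d(g\xi,g\eta)$ is complete.
   Context: An action of a group $G$ by homeomorphisms on a compact Hausdorff space $M$ is a convergence action if for every sequence $\{g_n\}$ of distinct elements of $G$ there are a subsequence $\{g_{n_i}\}$ and points $a,b\in M$ such that $g_{n_i}x\to b$ locally uniformly on $M\setminus\{a\}$. A compatible metric is a metric inducing the topology of $M$. The orbit uniform metric corresponding to a compatible metric $d$ is $d_u(\xi,\eta)=\sup_{g\in G}d(g\xi,g\eta)$. *)

theory Defs
  imports "HOL-Analysis.Analysis" "HOL-Algebra.Group_Action"
begin

text \<open>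
  A compact Hausdorff space carries exactly one uniformity inducing its topology, and its
  entourages are the neighbourhoods of the diagonal. Uniform convergence in such a space is
  uniform convergence with respect to this uniformity.
\<close>

definition converges_uniformly_on ::
    "'a topology \<Rightarrow> 'a set \<Rightarrow> (nat \<Rightarrow> 'a \<Rightarrow> 'a) \<Rightarrow> ('a \<Rightarrow> 'a) \<Rightarrow> bool" where
  "converges_uniformly_on X S f h \<longleftrightarrow>
     (\<forall>W. openin (prod_topology X X) W \<and> (\<forall>x \<in> topspace X. (x, x) \<in> W) \<longrightarrow>
        (\<forall>\<^sub>F n in sequentially. \<forall>x \<in> S. (f n x, h x) \<in> W))"

definition converges_locally_uniformly_on ::
    "'a topology \<Rightarrow> 'a set \<Rightarrow> (nat \<Rightarrow> 'a \<Rightarrow> 'a) \<Rightarrow> ('a \<Rightarrow> 'a) \<Rightarrow> bool" where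
  "converges_locally_uniformly_on X S f h \<longleftrightarrow>
     (\<forall>x \<in> S. \<exists>U. openin (subtopology X S) U \<and> x \<in> U \<and> converges_uniformly_on X U f h)"

locale convergence_action = group_action G "topspace X" \<phi>
  for G :: "('g, 'm) monoid_scheme" (structure)
  and X :: "'a topology"
  and \<phi> :: "'g \<Rightarrow> 'a \<Rightarrow> 'a" +
  assumes compact: "compact_space X"
    and Hausdorff: "Hausdorff_space X"
    and homeomorphic: "g \<in> carrier G \<Longrightarrow> homeomorphic_map X X (\<phi> g)"
    and convergence: "\<lbrakk>range s \<subseteq> carrier G; inj s\<rbrakk> \<Longrightarrow>
      \<exists>r a b. strict_mono (r :: nat \<Rightarrow> nat) \<and> a \<in> topspace X \<and> b \<in> topspace X \<and>
        converges_locally_uniformly_on X (topspace X - {a}) (\<lambda>i. \<phi> (s (r i))) (\<lambda>_. b)"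

definition compatible_metric :: "'a topology \<Rightarrow> ('a \<Rightarrow> 'a \<Rightarrow> real) \<Rightarrow> bool" where
  "compatible_metric X d \<longleftrightarrow>
     Metric_space (topspace X) d \<and> Metric_space.mtopology (topspace X) d = X"

text \<open>
  The locale \<^locale>\<open>Metric_space\<close> requires nonnegativity and symmetry also off the carrier,
  where the supremum is meaningless; hence the default value 0 there. On the carrier of a
  compact space the supremum is over a nonempty bounded set of reals.
\<close>

definition orbit_uniform_metric ::
    "('g, 'm) monoid_scheme \<Rightarrow> 'a set \<Rightarrow> ('g \<Rightarrow> 'a \<Rightarrow> 'a) \<Rightarrow> ('a \<Rightarrow> 'a \<Rightarrow> real) \<Rightarrow> 'a \<Rightarrow> 'a \<Rightarrow> real" where
  "orbit_uniform_metric G M \<phi> d \<xi> \<eta> =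
     (if \<xi> \<in> M \<and> \<eta> \<in> M then (SUP g \<in> carrier G. d (\<phi> g \<xi>) (\<phi> g \<eta>)) else 0)"

end

theory Submission
  imports Defs
begin

text \<open>
  Since \<^term>\<open>d\<close> is bounded by the orbit uniform metric (take the identity element), a sequence
  that is Cauchy for the latter converges in \<^term>\<open>d\<close> to some point \<open>x\<close>. The Cauchy estimate for
  \<open>d (g \<sigma>\<^sub>n) (g \<sigma>\<^sub>m)\<close> holds for all \<open>g\<close> simultaneously, and by continuity of each \<open>g\<close> it
  survives the limit \<open>m \<rightarrow> \<infinity>\<close>; so the convergence to \<open>x\<close> is uniform in \<open>g\<close>.
\<close>

context Metric_space
begin

context
  fixes G :: "('g, 'm) monoid_scheme" and \<phi> :: "'g \<Rightarrow> 'a \<Rightarrow> 'a"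
  assumes action: "group_action G M \<phi>"
    and bounded: "mbounded M"
begin

lemma action_closed: "g \<in> carrier G \<Longrightarrow> x \<in> M \<Longrightarrow> \<phi> g x \<in> M"
  using group_action.element_image[OF action] by blast

lemma one_closed: "\<one>\<^bsub>G\<^esub> \<in> carrier G"
  using action by (meson group_action.group_hom group.is_monoid group_hom_def monoid.one_closed)

text \<open>Boundedness of \<open>M\<close> bounds the family of distances above, so the real
  supremum is a genuine upper bound for its members.\<close>

lemma dist_le_orbit_uniform_metric:
  assumes "g \<in> carrier G" "x \<in> M" "y \<in> M"
  shows "d (\<phi> g x) (\<phi> g y) \<le> orbit_uniform_metric G M \<phi> d x y"
proof -
  obtain B where "\<And>x y. x \<in> M \<Longrightarrow> y \<in> M \<Longrightarrow> d x y \<le> B"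
    using bounded unfolding mbounded_alt by blast
  then have "bdd_above ((\<lambda>g. d (\<phi> g x) (\<phi> g y)) ` carrier G)"
    using assms action_closed by (intro bdd_aboveI2) blast
  then show ?thesis
    using assms by (auto simp: orbit_uniform_metric_def intro: cSUP_upper2)
qed

text \<open>A supremum of reals inherits an upper bound once the index set is nonempty; the identity
  of \<open>G\<close> witnesses this.\<close>

lemma orbit_uniform_metric_le:
  assumes "x \<in> M" "y \<in> M" and "\<And>g. g \<in> carrier G \<Longrightarrow> d (\<phi> g x) (\<phi> g y) \<le> e"
  shows "orbit_uniform_metric G M \<phi> d x y \<le> e"
  using assms one_closed by (auto simp: orbit_uniform_metric_def intro!: cSUP_least)

lemma metric_le_orbit_uniform_metric:
  assumes "x \<in> M" "y \<in> M"
  shows "d x y \<le> orbit_uniform_metric G M \<phi> d x y"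
  \<comment> \<open>The identity element acts as the identity map restricted to \<open>M\<close>, so
    its term in the supremum is \<open>d x y\<close> itself.\<close>
  using dist_le_orbit_uniform_metric[OF one_closed assms]
    group_action.id_eq_one[OF action] assms by (metis restrict_apply)

lemma Metric_space_orbit_uniform_metric:
  "Metric_space M (orbit_uniform_metric G M \<phi> d)"
proof
  fix x y
  show "0 \<le> orbit_uniform_metric G M \<phi> d x y"
  proof (cases "x \<in> M \<and> y \<in> M")
    case True
    then show ?thesis
      using metric_le_orbit_uniform_metric nonneg order_trans by blast
  \<comment> \<open>With a point outside \<open>M\<close> the default value 0 applies.\<close>
  qed (auto simp: orbit_uniform_metric_def)
  show "orbit_uniform_metric G M \<phi> d x y = orbit_uniform_metric G M \<phi> d y x"
    by (simp add: orbit_uniform_metric_def commute)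
next
  fix x y
  assume xy: "x \<in> M" "y \<in> M"
  show "orbit_uniform_metric G M \<phi> d x y = 0 \<longleftrightarrow> x = y"
  proof
    assume "orbit_uniform_metric G M \<phi> d x y = 0"
    then have "d x y = 0"
      using metric_le_orbit_uniform_metric[OF xy] nonneg[of x y] by linarith
    then show "x = y" using xy by simp
  next
    assume "x = y"
    then have "orbit_uniform_metric G M \<phi> d x y \<le> 0"
      using xy action_closed by (intro orbit_uniform_metric_le) auto
    then show "orbit_uniform_metric G M \<phi> d x y = 0"
      using metric_le_orbit_uniform_metric[OF xy] nonneg[of x y] by linarith
  qed
next
  fix x y z
  assume xyz: "x \<in> M" "y \<in> M" "z \<in> M"
  show "orbit_uniform_metric G M \<phi> d x z
      \<le> orbit_uniform_metric G M \<phi> d x y + orbit_uniform_metric G M \<phi> d y z"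
  \<comment> \<open>The right-hand side is free of the group element, so the triangle inequality for
    \<open>d\<close> may be applied to each term separately.\<close>
  proof (rule orbit_uniform_metric_le)
    fix g
    assume g: "g \<in> carrier G"
    have "d (\<phi> g x) (\<phi> g z) \<le> d (\<phi> g x) (\<phi> g y) + d (\<phi> g y) (\<phi> g z)"
      using g xyz by (intro triangle action_closed)
    also have "\<dots> \<le> orbit_uniform_metric G M \<phi> d x y + orbit_uniform_metric G M \<phi> d y z"
      using g xyz by (intro add_mono dist_le_orbit_uniform_metric)
    finally show "d (\<phi> g x) (\<phi> g z)
        \<le> orbit_uniform_metric G M \<phi> d x y + orbit_uniform_metric G M \<phi> d y z" .
  qed (use xyz in auto)
qed

lemma mcomplete_orbit_uniform_metric:
  assumes complete: "mcomplete"
    and continuous: "\<And>g. g \<in> carrier G \<Longrightarrow> continuous_map mtopology mtopology (\<phi> g)"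
  shows "Metric_space.mcomplete M (orbit_uniform_metric G M \<phi> d)"
proof -
  interpret U: Metric_space M "orbit_uniform_metric G M \<phi> d"
    by (rule Metric_space_orbit_uniform_metric)
  show ?thesis
    unfolding U.mcomplete_def
  proof (intro allI impI)
    fix \<sigma>
    assume cauchy: "U.MCauchy \<sigma>"
    then have \<sigma>: "\<sigma> n \<in> M" for n
      unfolding U.MCauchy_def by blast
    \<comment> \<open>Domination of \<open>d\<close> by the orbit uniform metric transfers the
      Cauchy property to \<open>d\<close>.\<close>
    have "MCauchy \<sigma>"
      unfolding MCauchy_def
      using cauchy \<sigma> metric_le_orbit_uniform_metric unfolding U.MCauchy_def
      by (meson image_subsetI order_le_less_trans)
    then obtain x where x: "limitin mtopology \<sigma> x sequentially"
      using complete unfolding mcomplete_def by blast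
    then have "x \<in> M" by (simp add: limitin_mspace)
    have "\<exists>N. \<forall>n\<ge>N. orbit_uniform_metric G M \<phi> d (\<sigma> n) x < e" if "e > 0" for e
    proof -
      obtain N where N: "\<And>n m. n \<ge> N \<Longrightarrow> m \<ge> N \<Longrightarrow>
          orbit_uniform_metric G M \<phi> d (\<sigma> n) (\<sigma> m) < e / 3"
        using cauchy \<open>e > 0\<close> unfolding U.MCauchy_def by (meson divide_pos_pos zero_less_numeral)
      \<comment> \<open>Strict bounds on the terms give only a non-strict bound on the supremum;
        stopping at \<open>2 * e / 3\<close> leaves room for a strict bound by
        \<open>e\<close>.\<close>
      have "orbit_uniform_metric G M \<phi> d (\<sigma> n) x \<le> 2 * e / 3" if "n \<ge> N" for n
      proof (rule orbit_uniform_metric_le)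
        fix g
        assume g: "g \<in> carrier G"
        have "limitin mtopology (\<phi> g \<circ> \<sigma>) (\<phi> g x) sequentially"
          using continuous[OF g] x by (rule continuous_map_limit)
        then obtain K where K: "\<And>m. m \<ge> K \<Longrightarrow> d (\<phi> g (\<sigma> m)) (\<phi> g x) < e / 3"
          using \<open>e > 0\<close> unfolding limit_metric_sequentially
          by (metis comp_apply divide_pos_pos zero_less_numeral)
        \<comment> \<open>The index \<open>K\<close>, and hence \<open>m\<close>, depends on
          \<open>g\<close>, but \<open>N\<close> does not. Since \<open>m\<close> drops out of the
          final estimate, that estimate is uniform in \<open>g\<close>.\<close>
        define m where "m = max N K"
        have "d (\<phi> g (\<sigma> n)) (\<phi> g x) \<le> d (\<phi> g (\<sigma> n)) (\<phi> g (\<sigma> m)) + d (\<phi> g (\<sigma> m)) (\<phi> g x)"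
          using g \<sigma> \<open>x \<in> M\<close> by (intro triangle action_closed)
        also have "\<dots> \<le> e / 3 + e / 3"
          using dist_le_orbit_uniform_metric[OF g \<sigma> \<sigma>, of n m] N[OF \<open>n \<ge> N\<close>, of m] K[of m]
          unfolding m_def by linarith
        finally show "d (\<phi> g (\<sigma> n)) (\<phi> g x) \<le> 2 * e / 3" by simp
      qed (use \<sigma> \<open>x \<in> M\<close> in auto)
      moreover have "2 * e / 3 < e" using \<open>e > 0\<close> by simp
      ultimately show ?thesis by (meson order_le_less_trans)
    qed
    then show "\<exists>x. limitin U.mtopology \<sigma> x sequentially"
      using \<sigma> \<open>x \<in> M\<close> by (intro exI[of _ x]) (simp add: U.limit_metric_sequentially)
  qed
qed

end

end

theorem theorem1p5:
  fixes G :: "('g, 'm) monoid_scheme"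
    and X :: "'a topology"
    and \<phi> :: "'g \<Rightarrow> 'a \<Rightarrow> 'a"
    and d :: "'a \<Rightarrow> 'a \<Rightarrow> real"
  assumes "compact_space X" and "metrizable_space X"
    and "convergence_action G X \<phi>"
    and "compatible_metric X d"
  shows "Metric_space (topspace X) (orbit_uniform_metric G (topspace X) \<phi> d) \<and>
         Metric_space.mcomplete (topspace X) (orbit_uniform_metric G (topspace X) \<phi> d)"
proof -
  interpret convergence_action G X \<phi> by fact
  interpret Metric_space "topspace X" d
    using assms(4) by (simp add: compatible_metric_def)
  have X: "mtopology = X"
    using assms(4) by (simp add: compatible_metric_def)
  \<comment> \<open>Compactness supplies both boundedness, which keeps the suprema finite, and
    completeness of \<open>d\<close>, which yields the candidate limit.\<close>
  have "compactin mtopology (topspace X)"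
    using assms(1) by (simp add: X compact_space_def)
  then have bounded: "mbounded (topspace X)"
    by (rule compactin_imp_mbounded)
  have complete: "mcomplete"
    using assms(1) by (simp add: X compact_space_imp_mcomplete)
  have "continuous_map mtopology mtopology (\<phi> g)" if "g \<in> carrier G" for g
    unfolding X using homeomorphic[OF that] by (rule homeomorphic_imp_continuous_map)
  then show ?thesis
    using Metric_space_orbit_uniform_metric[OF group_action_axioms bounded]
      mcomplete_orbit_uniform_metric[OF group_action_axioms bounded complete] by blast
qed

end
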